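(* Let $u_0 \in L^2(\mathbb{R})$ and let $u=u(x,t)$ be the global in time solution of the initial value problem $$\partial_t u - \mathcal{H}\partial_x^2 u + u\,\partial_x u = 0,\quad x,t\in\mathbb{R},\qquad u(x,0)=u_0(x),$$ with $u \in C(\mathbb{R}:L^2(\mathbb{R}))\cap L^{\infty}(\mathbb{R}:L^2(\mathbb{R}))$. Let $0<b<\tfrac{2}{3}$ and $B_{t^b}(0)=\{x\in\mathbb{R}: |x|<t^b\}$. Then $$\liminf_{t\to\infty}\int_{B_{t^b}(0)} u^2(x,t)\,dx = 0.$$ Moreover, there exist a constant $C>0$ and an increasing sequence of times $t_n\to\infty$ such that $$\int_{B_{t_n^b}(0)} u^2(x,t_n)\,dx \le \frac{C}{\log^{\frac{1-b}{b}}(t_n)}.$$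
   Context: $\mathcal{H}$ denotes the Hilbert transform on the line, $\mathcal{H}f(x)=\mathrm{p.v.}\frac{1}{\pi}\int_{\mathbb{R}}\frac{f(y)}{x-y}\,dy$. The equation is the Benjamin–Ono equation; $u$ is real-valued. *)

theory Defs
  imports "HOL-Analysis.Analysis"
begin

definition L2 :: "(real \<Rightarrow> real) \<Rightarrow> bool" where
  "L2 f \<longleftrightarrow> f \<in> borel_measurable lborel \<and> integrable lborel (\<lambda>x. (f x)\<^sup>2)"

definition test_fun :: "(real \<Rightarrow> real) \<Rightarrow> bool" where
  "test_fun \<phi> \<longleftrightarrow> (\<forall>k x. ((deriv ^^ k) \<phi>) differentiable (at x))
                   \<and> (\<exists>R. \<forall>x. R < \<bar>x\<bar> \<longrightarrow> \<phi> x = 0)"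

definition hilbert :: "(real \<Rightarrow> real) \<Rightarrow> real \<Rightarrow> real" where
  "hilbert f x = Lim (at_right 0)
     (\<lambda>\<epsilon>. (1 / pi) * (LINT y:{y. \<epsilon> < \<bar>x - y\<bar>}|lborel. f y / (x - y)))"

definition C_L2 :: "(real \<Rightarrow> real \<Rightarrow> real) \<Rightarrow> bool" where
  "C_L2 u \<longleftrightarrow> (\<forall>t. L2 (\<lambda>x. u x t)) \<and>
     (\<forall>t. ((\<lambda>s. LINT x|lborel. (u x s - u x t)\<^sup>2) \<longlongrightarrow> 0) (at t))"

definition Linf_L2 :: "(real \<Rightarrow> real \<Rightarrow> real) \<Rightarrow> bool" where
  "Linf_L2 u \<longleftrightarrow> (\<exists>M. \<forall>t. (LINT x|lborel. (u x t)\<^sup>2) \<le> M)"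

text \<open>Weak (integral-in-time, distributional-in-space) solution of
  u_t - H u_xx + u u_x = 0, u(.,0) = u0: for every test function phi and every t,
  int u(x,t) phi(x) dx = int u0 phi dx
     + int_0^t int ( - u(x,s) (H phi'')(x) + u(x,s)^2/2 phi'(x) ) dx ds.\<close>
definition BO_solution :: "(real \<Rightarrow> real) \<Rightarrow> (real \<Rightarrow> real \<Rightarrow> real) \<Rightarrow> bool" where
  "BO_solution u0 u \<longleftrightarrow>
     C_L2 u \<and> Linf_L2 u \<and> (AE x in lborel. u x 0 = u0 x) \<and>
     (\<forall>\<phi> t. test_fun \<phi> \<longrightarrow>
        (LINT x|lborel. u x t * \<phi> x) =
        (LINT x|lborel. u0 x * \<phi> x) +
        (LBINT s=0..t. (LINT x|lborel.
            - u x s * hilbert (deriv (deriv \<phi>)) x + (u x s)\<^sup>2 / 2 * deriv \<phi> x)))"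

end

theory Submission
  imports Defs "HOL-Computational_Algebra.Polynomial" "HOL-Probability.Sinc_Integral"
    "HOL-Real_Asymp.Real_Asymp"
begin

text \<open>
  Test the equation on a dyadic time interval $[T, 2T]$ against the fixed function
  $\phi(x) = R\,(G(x/R) - G(x/L))$, where $G' = g$ is a nonnegative bump, $R \sim T^b$ and
  $L = T^{1-b/2}$. Near the origin $\phi' \ge c > 0$ up to an error $R/L$, which is also the size of
  the negative part of $\phi'$; hence the time average of the local mass is bounded by a constant times
  $R L^{1/2}/T$ (boundary terms, Cauchy-Schwarz) $+\ R/L$ $+\ R^{-1/2}$ (dispersive term, since
  $\mathcal{H}\phi''$ consists of dilates of $\mathcal{H}g' \in L^2$). For $b < 2/3$ this is a negative power
  of $T$, which beats every power of the logarithm.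
\<close>

section \<open>A smooth bump and its derivatives\<close>

text \<open>The weight is paired with \<open>u\<close> itself, not with \<open>u\<^sup>2\<close>:
  the equation is a conservation law with flux \<open>u\<^sup>2 / 2\<close>, so the local mass
  appears directly from the nonlinear term, with the sign of \<phi>'. The test functions of the weak
  formulation do not depend on time, which is why \<phi> is frozen over a dyadic window. The
  obstacle is that a function with \<phi>' >= 0 and compact support is trivial. Subtracting the slow
  dilate of G restores compact support, at the price of a weight of size R on an interval of length
  of order L, whose L2 norm is of order R L^(1/2). Two demands on L compete: R must be small against
  L (negative part of \<phi>') and R L^(1/2) small against T (boundary terms). With R of order T^b
  they read T^b << L << T^(2 - 2b). This range is nonempty exactly for b < 2/3, and T^(1 - b/2) is
  the geometric mean of its ends.\<close>

definition bump_term :: "real poly \<Rightarrow> nat \<Rightarrow> real \<Rightarrow> real" where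
  "bump_term p n x = (if \<bar>x\<bar> < 1 then poly p x / (1 - x\<^sup>2) ^ n * exp (- 1 / (1 - x\<^sup>2)) else 0)"

text \<open>Numerator of the derivative of \<open>p / w ^ n * exp (- 1 / w)\<close> with \<open>w = 1 - x\<^sup>2\<close>, over \<open>w ^ (n + 2)\<close>.\<close>
definition bump_pderiv :: "real poly \<Rightarrow> nat \<Rightarrow> real poly" where
  "bump_pderiv p n = pderiv p * [:1, 0, -1:]\<^sup>2 + smult (2 * real n) ([:0, 1:] * p * [:1, 0, -1:]) - [:0, 2:] * p"

lemma bump_term_eq_0: "1 \<le> \<bar>x\<bar> \<Longrightarrow> bump_term p n x = 0"
  by (simp add: bump_term_def)

lemma one_minus_square_pos: "\<bar>x\<bar> < 1 \<Longrightarrow> 0 < 1 - (x::real)\<^sup>2"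
  by (simp add: abs_square_less_1)

text \<open>A single term of the exponential series, (1/w)^m / m!, is a lower bound for exp (1/w);
  then take inverses.\<close>

lemma exp_neg_inverse_le:
  fixes w :: real
  assumes "0 < w"
  shows "exp (- 1 / w) \<le> fact m * w ^ m"
proof -
  have "(1 / w) ^ m / fact m \<le> exp (1 / w)"
  proof -
    have s: "(\<lambda>k. (1 / w) ^ k /\<^sub>R fact k) sums exp (1 / w)" by (rule exp_converges)
    have "sum (\<lambda>k. (1 / w) ^ k /\<^sub>R fact k) {m} \<le> exp (1 / w)"
      unfolding sums_unique[OF s]
      by (rule sum_le_suminf[OF sums_summable[OF s]]) (use assms in auto)
    then show ?thesis by (simp add: field_simps)
  qed
  then have "inverse (exp (1 / w)) \<le> inverse ((1 / w) ^ m / fact m)"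
    by (rule le_imp_inverse_le) (use assms in simp)
  then show ?thesis using assms by (simp add: exp_minus field_simps)
qed

text \<open>The exponential is bounded by a multiple of w^(n + 2) with w = 1 - x^2: n powers cancel
  the pole, and the two that remain make the function vanish to second order at the points 1 and
  -1.\<close>

lemma bump_term_quadratic_bound:
  obtains C where "\<And>x. \<bar>bump_term p n x\<bar> \<le> C * (1 - x\<^sup>2)\<^sup>2" "0 \<le> C"
proof -
  have "compact (poly p ` {-1..1})"
    by (intro compact_continuous_image continuous_intros compact_Icc)
  then obtain B where B: "\<And>x. x \<in> {-1..1} \<Longrightarrow> \<bar>poly p x\<bar> \<le> B"
    by (metis bounded_iff compact_imp_bounded imageI real_norm_def)
  have B0: "0 \<le> B" using B[of 0] by auto
  show ?thesis
  proof (rule that[of "B * fact (n + 2)"])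
    fix x :: real
    show "\<bar>bump_term p n x\<bar> \<le> B * fact (n + 2) * (1 - x\<^sup>2)\<^sup>2"
    proof (cases "\<bar>x\<bar> < 1")
      case True
      define w where "w = 1 - x\<^sup>2"
      have w: "0 < w" unfolding w_def by (rule one_minus_square_pos[OF True])
      have "\<bar>bump_term p n x\<bar> = \<bar>poly p x\<bar> / w ^ n * exp (- 1 / w)"
        using True w by (simp add: bump_term_def abs_mult w_def[symmetric])
      also have "\<dots> \<le> B / w ^ n * (fact (n + 2) * w ^ (n + 2))"
        using True w B0 by (intro mult_mono divide_right_mono B exp_neg_inverse_le) auto
      also have "\<dots> = B * fact (n + 2) * w\<^sup>2"
        using w by (simp add: power_add power2_eq_square)
      finally show ?thesis by (simp add: w_def)
    qed (use B0 in \<open>simp add: bump_term_eq_0\<close>)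
  qed (use B0 in simp)
qed

lemma bump_term_deriv_inside:
  assumes "\<bar>x\<bar> < 1"
  shows "(bump_term p n has_real_derivative bump_term (bump_pderiv p n) (n + 2) x) (at x)"
proof -
  define w where "w = 1 - x\<^sup>2"
  have w: "0 < w" unfolding w_def by (rule one_minus_square_pos[OF assms])
  have der: "((\<lambda>x. poly p x / (1 - x\<^sup>2) ^ n * exp (- 1 / (1 - x\<^sup>2))) has_real_derivative
     (poly (pderiv p) x * w ^ n - poly p x * (real n * w ^ (n - 1) * (- 2 * x))) / (w ^ n * w ^ n) * exp (- 1 / w)
      + (- (2 * x) / (w * w)) * exp (- 1 / w) * (poly p x / w ^ n)) (at x)"
  proof -
    have 1: "((\<lambda>x. (1 - x\<^sup>2) ^ n) has_real_derivative real n * w ^ (n - 1) * (- 2 * x)) (at x)"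
      unfolding w_def by (auto intro!: derivative_eq_intros)
    have "((\<lambda>x. - 1 / (1 - x\<^sup>2)) has_real_derivative - (2 * x) / (w * w)) (at x)"
      using w unfolding w_def by (auto intro!: derivative_eq_intros)
    from DERIV_fun_exp[OF this]
    have 2: "((\<lambda>x. exp (- 1 / (1 - x\<^sup>2))) has_real_derivative (- (2 * x) / (w * w)) * exp (- 1 / w)) (at x)"
      by (simp add: w_def mult.commute)
    show ?thesis
      using DERIV_mult[OF DERIV_divide[OF poly_DERIV 1] 2, of p] w by (simp add: w_def)
  qed
  \<comment> \<open>Removes the truncated subtraction \<open>n - 1\<close> before the algebra; for
    \<open>n = 0\<close> both sides vanish.\<close>
  have n: "real n * w ^ (n - 1) = real n * w ^ n / w"
    using w by (cases n) auto
  have "(poly (pderiv p) x * w ^ n - poly p x * (real n * w ^ (n - 1) * (- 2 * x))) / (w ^ n * w ^ n) * exp (- 1 / w)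
      + (- (2 * x) / (w * w)) * exp (- 1 / w) * (poly p x / w ^ n)
     = (poly (pderiv p) x * w\<^sup>2 + 2 * real n * (x * poly p x * w) - 2 * x * poly p x) / w ^ (n + 2) * exp (- 1 / w)"
    unfolding n using w by (simp add: field_simps power2_eq_square)
  also have "\<dots> = bump_term (bump_pderiv p n) (n + 2) x"
    using assms by (simp add: bump_term_def bump_pderiv_def w_def power2_eq_square algebra_simps)
  finally have "((\<lambda>x. poly p x / (1 - x\<^sup>2) ^ n * exp (- 1 / (1 - x\<^sup>2))) has_real_derivative
     bump_term (bump_pderiv p n) (n + 2) x) (at x)"
    using der by simp
  then show ?thesis
  proof (rule has_field_derivative_transform_within_open[where S = "{-1<..<1}"])
    show "x \<in> {-1<..<1}" using assms by auto
  qed (auto simp: bump_term_def abs_less_iff)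
qed

text \<open>The case to settle is |x| >= 1, boundary points included. There 1 - y^2 = (1 - |y|)(1 +
  |y|) <= 2|y - x| for |y| < 1, so the second-order vanishing makes the difference quotient at x of
  order |y - x|, and the derivative is 0, the value of every \<open>bump_term\<close> at x.\<close>

lemma bump_term_deriv:
  "(bump_term p n has_real_derivative bump_term (bump_pderiv p n) (n + 2) x) (at x)"
proof (cases "\<bar>x\<bar> < 1")
  case True
  then show ?thesis by (rule bump_term_deriv_inside)
next
  case False
  obtain C where C: "\<And>y. \<bar>bump_term p n y\<bar> \<le> C * (1 - y\<^sup>2)\<^sup>2" "0 \<le> C"
    using bump_term_quadratic_bound[of p n] by blast
  have quad: "\<bar>bump_term p n y\<bar> \<le> 4 * C * (y - x)\<^sup>2" for y
  proof (cases "\<bar>y\<bar> < 1")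
    case True
    have "0 \<le> 1 - y\<^sup>2" using one_minus_square_pos[OF True] by simp
    moreover have "1 - y\<^sup>2 \<le> 2 * \<bar>y - x\<bar>"
    proof -
      have "1 - y\<^sup>2 = (1 - \<bar>y\<bar>) * (1 + \<bar>y\<bar>)" by (simp add: algebra_simps power2_eq_square)
      also have "\<dots> \<le> \<bar>y - x\<bar> * 2" using True False by (intro mult_mono) auto
      finally show ?thesis by simp
    qed
    ultimately have "(1 - y\<^sup>2)\<^sup>2 \<le> (2 * \<bar>y - x\<bar>)\<^sup>2" by (intro power_mono) auto
    then have "(1 - y\<^sup>2)\<^sup>2 \<le> 4 * (y - x)\<^sup>2" by (simp add: power_mult_distrib)
    then have "C * (1 - y\<^sup>2)\<^sup>2 \<le> C * (4 * (y - x)\<^sup>2)" using C(2) by (rule mult_left_mono)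
    then show ?thesis using C(1)[of y] by simp
  qed (use C in \<open>simp add: bump_term_eq_0\<close>)
  have "((\<lambda>y. (bump_term p n y - bump_term p n x) / (y - x)) \<longlongrightarrow> 0) (at x)"
  proof (rule Lim_null_comparison)
    show "\<forall>\<^sub>F y in at x. norm ((bump_term p n y - bump_term p n x) / (y - x)) \<le> 4 * C * \<bar>y - x\<bar>"
    proof (rule always_eventually, rule allI)
      fix y
      have "\<bar>bump_term p n y\<bar> / \<bar>y - x\<bar> \<le> 4 * C * (y - x)\<^sup>2 / \<bar>y - x\<bar>"
        by (intro divide_right_mono quad) auto
      also have "\<dots> \<le> 4 * C * \<bar>y - x\<bar>"
        by (cases "y = x") (auto simp: power2_eq_square abs_mult[symmetric] divide_simps)
      finally show "norm ((bump_term p n y - bump_term p n x) / (y - x)) \<le> 4 * C * \<bar>y - x\<bar>"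
        using False by (simp add: bump_term_eq_0 abs_divide)
    qed
    show "((\<lambda>y. 4 * C * \<bar>y - x\<bar>) \<longlongrightarrow> 0) (at x)"
      by (rule tendsto_eq_intros refl | simp)+
  qed
  then show ?thesis using False
    by (simp add: has_field_derivative_iff bump_term_eq_0)
qed

lemma continuous_bump_term [continuous_intros]:
  assumes "continuous_on A f"
  shows "continuous_on A (\<lambda>x. bump_term p n (f x))"
proof -
  have "continuous_on UNIV (bump_term p n)"
    by (intro continuous_at_imp_continuous_on ballI DERIV_isCont[OF bump_term_deriv])
  from continuous_on_compose2[OF this assms] show ?thesis by auto
qed

lemma bump_term_measurable [measurable]: "bump_term p n \<in> borel_measurable borel"
  by (intro borel_measurable_continuous_onI continuous_intros)

lemma bump_term_bounded: "\<exists>B. \<forall>x. \<bar>bump_term p n x\<bar> \<le> B"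
proof -
  have "compact (bump_term p n ` {-1..1})"
    by (intro compact_continuous_image continuous_intros compact_Icc)
  then obtain B where B: "\<And>x. x \<in> {-1..1} \<Longrightarrow> \<bar>bump_term p n x\<bar> \<le> B"
    by (metis bounded_iff compact_imp_bounded imageI real_norm_def)
  have "0 \<le> B" using B[of 0] by auto
  then have "\<bar>bump_term p n x\<bar> \<le> B" for x
    using B[of x] bump_term_eq_0[of x p n] by (cases "\<bar>x\<bar> \<le> 1") (auto simp: abs_le_iff)
  then show ?thesis by blast
qed

text \<open>The derivative is again a \<open>bump_term\<close>, hence bounded. The Lipschitz
  constant is what the Hilbert transform estimates consume.\<close>

lemma bump_term_lipschitz: "\<exists>C. \<forall>x y. \<bar>bump_term p n x - bump_term p n y\<bar> \<le> C * \<bar>x - y\<bar>"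
proof -
  obtain B where B: "\<And>x. \<bar>bump_term (bump_pderiv p n) (n + 2) x\<bar> \<le> B"
    using bump_term_bounded[of "bump_pderiv p n" "n + 2"] by blast
  have "\<bar>bump_term p n x - bump_term p n y\<bar> \<le> B * \<bar>x - y\<bar>" for x y
    using field_differentiable_bound[of UNIV "bump_term p n" "bump_term (bump_pderiv p n) (n + 2)" B x y]
      bump_term_deriv B by simp
  then show ?thesis by blast
qed

lemma funpow_deriv_invariant:
  assumes "f \<in> S" and "\<And>f. f \<in> S \<Longrightarrow> deriv f \<in> S"
  shows "(deriv ^^ k) f \<in> S"
  by (induction k) (use assms in auto)

lemma two_scale_deriv:
  "((\<lambda>x. a * bump_term p n (x / R) - d * bump_term q m (x / L)) has_real_derivative
     (a / R) * bump_term (bump_pderiv p n) (n + 2) (x / R) - (d / L) * bump_term (bump_pderiv q m) (m + 2) (x / L)) (at x)"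
proof -
  have s: "((\<lambda>x. bump_term p n (x / R)) has_real_derivative
     bump_term (bump_pderiv p n) (n + 2) (x / R) * (1 / R)) (at x)" for p n x R
    by (rule DERIV_chain2[OF bump_term_deriv]) (rule DERIV_cdivide DERIV_ident)+
  show ?thesis
    by (rule DERIV_cong[OF DERIV_diff[OF DERIV_cmult[OF s] DERIV_cmult[OF s]]]) simp
qed

text \<open>Differentiation only changes the coefficients, polynomials and pole orders, so the
  family of all such combinations is invariant under \<open>deriv\<close>, and each member is
  differentiable. Both summands carry their own polynomial and order to keep the family
  closed.\<close>

lemma two_scale_smooth:
  "((deriv ^^ k) (\<lambda>x. a * bump_term p n (x / R) - d * bump_term q m (x / L))) differentiable (at x)"
proof -
  let ?S = "{\<lambda>x. a * bump_term p n (x / R) - d * bump_term q m (x / L) | a d p n q m. True}"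
  have "deriv f \<in> ?S" if f: "f \<in> ?S" for f
  proof -
    obtain a d p n q m where f: "f = (\<lambda>x. a * bump_term p n (x / R) - d * bump_term q m (x / L))"
      using f by auto
    have "deriv f = (\<lambda>x. (a / R) * bump_term (bump_pderiv p n) (n + 2) (x / R)
        - (d / L) * bump_term (bump_pderiv q m) (m + 2) (x / L))"
      unfolding f by (intro ext DERIV_imp_deriv two_scale_deriv)
    then show ?thesis by blast
  qed
  then have "(deriv ^^ k) (\<lambda>x. a * bump_term p n (x / R) - d * bump_term q m (x / L)) \<in> ?S"
    by (intro funpow_deriv_invariant) blast+
  moreover have "f differentiable (at x)" if "f \<in> ?S" for f
    unfolding real_differentiable_def using that two_scale_deriv by blast
  ultimately show ?thesis by blast
qed

section \<open>Hilbert transform of compactly supported Lipschitz functions\<close>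

text \<open>
  The integrability clause is needed for linearity: a truncated integral that does not exist has value 0.
\<close>
definition has_hilbert :: "(real \<Rightarrow> real) \<Rightarrow> real \<Rightarrow> real \<Rightarrow> bool" where
  "has_hilbert h x l \<longleftrightarrow>
     (\<forall>\<epsilon>>0. set_integrable lborel {y. \<epsilon> < \<bar>x - y\<bar>} (\<lambda>y. h y / (x - y))) \<and>
     ((\<lambda>\<epsilon>. (1 / pi) * (LINT y:{y. \<epsilon> < \<bar>x - y\<bar>}|lborel. h y / (x - y))) \<longlongrightarrow> l) (at_right 0)"

lemma has_hilbert_imp_hilbert: "has_hilbert h x l \<Longrightarrow> hilbert h x = l"
  unfolding has_hilbert_def hilbert_def by (intro tendsto_Lim) auto

lemma has_hilbert_linear:
  assumes "has_hilbert h1 x l1" "has_hilbert h2 x l2"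
  shows "has_hilbert (\<lambda>y. a * h1 y - d * h2 y) x (a * l1 - d * l2)"
proof -
  have e: "(a * h1 y - d * h2 y) / (x - y) = a * (h1 y / (x - y)) - d * (h2 y / (x - y))" for y
    by (simp add: diff_divide_distrib)
  let ?J = "\<lambda>h \<epsilon>. LINT y:{y. \<epsilon> < \<bar>x - y\<bar>}|lborel. h y / (x - y)"
  have int: "set_integrable lborel {y. \<epsilon> < \<bar>x - y\<bar>} (\<lambda>y. a * (h1 y / (x - y)))"
    "set_integrable lborel {y. \<epsilon> < \<bar>x - y\<bar>} (\<lambda>y. d * (h2 y / (x - y)))" if "\<epsilon> > 0" for \<epsilon>
    using assms that unfolding has_hilbert_def by (intro set_integrable_mult_right; blast)+
  have J: "?J (\<lambda>y. a * h1 y - d * h2 y) \<epsilon> = a * ?J h1 \<epsilon> - d * ?J h2 \<epsilon>" if "\<epsilon> > 0" for \<epsilon>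
    unfolding e using set_integral_diff(2)[OF int[OF that]]
    by (simp only: set_integral_mult_right)
  have "((\<lambda>\<epsilon>. a * ((1 / pi) * ?J h1 \<epsilon>) - d * ((1 / pi) * ?J h2 \<epsilon>)) \<longlongrightarrow> a * l1 - d * l2) (at_right 0)"
    using assms unfolding has_hilbert_def by (intro tendsto_intros) auto
  moreover have "\<forall>\<^sub>F \<epsilon> in at_right 0. a * ((1 / pi) * ?J h1 \<epsilon>) - d * ((1 / pi) * ?J h2 \<epsilon>)
      = (1 / pi) * ?J (\<lambda>y. a * h1 y - d * h2 y) \<epsilon>"
    using eventually_at_right_less[of "0::real"]
    by eventually_elim (simp only: J, simp add: field_simps)
  ultimately have "((\<lambda>\<epsilon>. (1 / pi) * ?J (\<lambda>y. a * h1 y - d * h2 y) \<epsilon>) \<longlongrightarrow> a * l1 - d * l2) (at_right 0)"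
    by (rule Lim_transform_eventually)
  moreover have "set_integrable lborel {y. \<epsilon> < \<bar>x - y\<bar>} (\<lambda>y. (a * h1 y - d * h2 y) / (x - y))" if "\<epsilon> > 0" for \<epsilon>
    unfolding e by (rule set_integral_diff(1)[OF int[OF that]])
  ultimately show ?thesis unfolding has_hilbert_def by blast
qed

text \<open>The measure dy / (x - y) is invariant under y = R z, x = R x'. The substitution only
  turns the truncation \<epsilon> into \<epsilon> / R, which again tends to 0 from the
  right.\<close>

lemma has_hilbert_dilation:
  assumes "has_hilbert h (x / R) l" "0 < R"
  shows "has_hilbert (\<lambda>y. h (y / R)) x l"
proof -
  let ?f = "\<lambda>\<epsilon> y. indicator {y. \<epsilon> < \<bar>x - y\<bar>} y *\<^sub>R (h (y / R) / (x - y))"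
  let ?g = "\<lambda>\<epsilon> y. indicator {y. \<epsilon> < \<bar>x / R - y\<bar>} y *\<^sub>R (h y / (x / R - y))"
  have fg: "?f \<epsilon> (0 + R * z) = (1 / R) * ?g (\<epsilon> / R) z" for \<epsilon> z
  proof -
    have d: "x - R * z = R * (x / R - z)" using assms(2) by (simp add: field_simps)
    have "\<epsilon> < \<bar>x - R * z\<bar> \<longleftrightarrow> \<epsilon> / R < \<bar>x / R - z\<bar>"
      unfolding d abs_mult using assms(2) by (simp add: field_simps)
    moreover have "h (R * z / R) / (x - R * z) = (1 / R) * (h z / (x / R - z))"
      unfolding d using assms(2) by simp
    ultimately show ?thesis by (simp add: indicator_def)
  qed
  have "integrable lborel (?f \<epsilon>)" if "\<epsilon> > 0" for \<epsilon>
  proof -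
    have "integrable lborel (\<lambda>z. (1 / R) * ?g (\<epsilon> / R) z)"
      using assms that unfolding has_hilbert_def set_integrable_def by (intro integrable_mult_right) auto
    then show ?thesis
      using lborel_integrable_real_affine_iff[of R "?f \<epsilon>" 0] assms(2) unfolding fg by simp
  qed
  moreover have "((\<lambda>\<epsilon>. (1 / pi) * (\<integral>y. ?f \<epsilon> y \<partial>lborel)) \<longlongrightarrow> l) (at_right 0)"
  proof -
    have "(\<integral>y. ?f \<epsilon> y \<partial>lborel) = (\<integral>y. ?g (\<epsilon> / R) y \<partial>lborel)" for \<epsilon>
    proof -
      have "(\<integral>y. ?f \<epsilon> y \<partial>lborel) = R * (\<integral>z. (1 / R) * ?g (\<epsilon> / R) z \<partial>lborel)"
        using lborel_integral_real_affine[of R "?f \<epsilon>" 0] assms(2) unfolding fg by simp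
      then show ?thesis using assms(2) by (simp only: integral_mult_right_zero) simp
    qed
    moreover have "((\<lambda>\<epsilon>. (1 / pi) * (\<integral>y. ?g (\<epsilon> / R) y \<partial>lborel)) \<longlongrightarrow> l) (at_right 0)"
    proof (rule filterlim_compose[where g = "\<lambda>\<epsilon>. (1 / pi) * (\<integral>y. ?g \<epsilon> y \<partial>lborel)"])
      show "((\<lambda>\<epsilon>. (1 / pi) * (\<integral>y. ?g \<epsilon> y \<partial>lborel)) \<longlongrightarrow> l) (at_right 0)"
        using assms(1) unfolding has_hilbert_def set_lebesgue_integral_def by blast
      have "((\<lambda>\<epsilon>. \<epsilon> / R) \<longlongrightarrow> 0) (at_right 0)"
        by (rule tendsto_eq_intros refl | use assms(2) in simp)+
      moreover have "\<forall>\<^sub>F \<epsilon> in at_right 0. \<epsilon> / R \<in> {0<..} \<and> \<epsilon> / R \<noteq> 0"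
        using eventually_at_right_less[of "0::real"] by eventually_elim (use assms(2) in simp)
      ultimately show "filterlim (\<lambda>\<epsilon>. \<epsilon> / R) (at_right 0) (at_right 0)"
        by (simp add: filterlim_at eventually_conj_iff)
    qed
    ultimately show ?thesis by simp
  qed
  ultimately show ?thesis unfolding has_hilbert_def set_integrable_def set_lebesgue_integral_def by blast
qed

text \<open>The odd kernel \<open>1 / z\<close> is symmetrised, so that the singularity at 0 cancels.\<close>
definition hilbert_kernel :: "(real \<Rightarrow> real) \<Rightarrow> real \<Rightarrow> real \<Rightarrow> real" where
  "hilbert_kernel h x z = (h (x - z) - h (x + z)) / (2 * z)"

section \<open>Symmetrised kernel of a Lipschitz function supported in [-1, 1]\<close>

context
  fixes h :: "real \<Rightarrow> real" and C :: real
  assumes h_meas [measurable]: "h \<in> borel_measurable borel"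
    and lip: "\<And>x y. \<bar>h x - h y\<bar> \<le> C * \<bar>x - y\<bar>"
    and supp: "\<And>x. 1 \<le> \<bar>x\<bar> \<Longrightarrow> h x = 0"
begin

lemma lipschitz_const_nonneg: "0 \<le> C"
  using lip[of 0 1] by auto

text \<open>Compare with the zero at 1, which is at distance at most 2 from each point of
  [-1, 1].\<close>

lemma bounded_of_lipschitz: "\<bar>h x\<bar> \<le> 2 * C * indicator {-1..1} x"
proof (cases "\<bar>x\<bar> \<le> 1")
  case True
  have "\<bar>h x\<bar> \<le> C * \<bar>x - 1\<bar>" using lip[of x 1] supp[of 1] by simp
  also have "\<dots> \<le> C * 2" using True lipschitz_const_nonneg by (intro mult_left_mono) auto
  finally show ?thesis using True by (simp add: abs_le_iff)
qed (use supp lipschitz_const_nonneg in simp)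

lemma hilbert_kernel_measurable [measurable]:
  "(\<lambda>(x, z). hilbert_kernel h x z) \<in> borel_measurable (borel \<Otimes>\<^sub>M borel)"
  unfolding hilbert_kernel_def by measurable

lemma hilbert_kernel_measurable' [measurable]: "hilbert_kernel h x \<in> borel_measurable borel"
  unfolding hilbert_kernel_def by measurable

text \<open>The points x - z and x + z are 2|z| apart, so the Lipschitz bound cancels the
  denominator. For |z| > |x| + 1 both points lie outside the support. At z = 0 the quotient is 0 by
  the convention for division.\<close>

lemma hilbert_kernel_bound:
  "\<bar>hilbert_kernel h x z\<bar> \<le> C * indicator {-(\<bar>x\<bar> + 1)..\<bar>x\<bar> + 1} z"
proof (cases "z \<in> {-(\<bar>x\<bar> + 1)..\<bar>x\<bar> + 1}")
  case True
  have "\<bar>h (x - z) - h (x + z)\<bar> \<le> C * (2 * \<bar>z\<bar>)"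
    using lip[of "x - z" "x + z"] by simp
  then have "\<bar>h (x - z) - h (x + z)\<bar> / (2 * \<bar>z\<bar>) \<le> C"
    using lipschitz_const_nonneg by (cases "z = 0") (auto simp: field_simps)
  then show ?thesis using True by (simp add: hilbert_kernel_def abs_mult)
next
  case False
  then have "h (x - z) = 0" "h (x + z) = 0" by (auto intro!: supp)
  then show ?thesis using False by (simp add: hilbert_kernel_def)
qed

lemma hilbert_kernel_integrable: "integrable lborel (hilbert_kernel h x)"
proof (rule Bochner_Integration.integrable_bound)
  show "integrable lborel (\<lambda>z. C * indicator {-(\<bar>x\<bar> + 1)..\<bar>x\<bar> + 1} z)"
    by (intro integrable_mult_right integrable_real_indicator) auto
  show "AE z in lborel. norm (hilbert_kernel h x z) \<le> norm (C * indicator {-(\<bar>x\<bar> + 1)..\<bar>x\<bar> + 1} z)"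
    using hilbert_kernel_bound[of x] lipschitz_const_nonneg by simp
qed simp

text \<open>The substitutions y = x - z and y = x + z give the same integral with kernels 1/z and
  -1/z over the symmetric set |z| > \<epsilon>; their average is the symmetrised kernel.\<close>

lemma truncated_hilbert:
  assumes "\<epsilon> > 0"
  shows "integrable lborel (\<lambda>y. indicator {y. \<epsilon> < \<bar>x - y\<bar>} y *\<^sub>R (h y / (x - y)))" (is "integrable lborel ?f")
    and "(\<integral>y. indicator {y. \<epsilon> < \<bar>x - y\<bar>} y *\<^sub>R (h y / (x - y)) \<partial>lborel) = (\<integral>z. indicator {z. \<epsilon> < \<bar>z\<bar>} z * hilbert_kernel h x z \<partial>lborel)"
proof -
  show int: "integrable lborel ?f"
  proof (rule Bochner_Integration.integrable_bound)
    show "integrable lborel (\<lambda>y::real. (2 * C / \<epsilon>) * indicator {-1..1} y)"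
      by (intro integrable_mult_right integrable_real_indicator) auto
    have "\<bar>?f y\<bar> \<le> (2 * C / \<epsilon>) * indicator {-1..1} y" for y
    proof (cases "\<epsilon> < \<bar>x - y\<bar>")
      case True
      have "\<bar>h y\<bar> / \<bar>x - y\<bar> \<le> (2 * C * indicator {-1..1} y) / \<epsilon>"
        using True assms bounded_of_lipschitz[of y] lipschitz_const_nonneg by (intro frac_le) auto
      then show ?thesis using True by simp
    qed (use assms lipschitz_const_nonneg in simp)
    then show "AE y in lborel. norm (?f y) \<le> norm ((2 * C / \<epsilon>) * indicator {-1..1} y)"
      using assms lipschitz_const_nonneg by simp
  qed measurable
  let ?p = "\<lambda>z. ?f (x + -1 * z)" and ?q = "\<lambda>z. ?f (x + 1 * z)"
  have pi: "integrable lborel ?p" "integrable lborel ?q"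
    by (rule lborel_integrable_real_affine[OF int], simp)+
  have pq: "(\<integral>y. ?f y \<partial>lborel) = (\<integral>z. ?p z \<partial>lborel)" "(\<integral>y. ?f y \<partial>lborel) = (\<integral>z. ?q z \<partial>lborel)"
    using lborel_integral_real_affine[of "-1" ?f x] lborel_integral_real_affine[of 1 ?f x] by simp_all
  have "(\<integral>y. ?f y \<partial>lborel) = (\<integral>z. ?p z \<partial>lborel) / 2 + (\<integral>z. ?q z \<partial>lborel) / 2"
    using pq by simp
  also have "\<dots> = (\<integral>z. ?p z / 2 + ?q z / 2 \<partial>lborel)"
    by (simp only: Bochner_Integration.integral_add[OF integrable_divide_zero integrable_divide_zero] pi
        integral_divide_zero)
  also have "\<dots> = (\<integral>z. indicator {z. \<epsilon> < \<bar>z\<bar>} z * hilbert_kernel h x z \<partial>lborel)"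
    by (intro Bochner_Integration.integral_cong)
      (auto simp: hilbert_kernel_def indicator_def diff_divide_distrib)
  finally show "(\<integral>y. ?f y \<partial>lborel) = (\<integral>z. indicator {z. \<epsilon> < \<bar>z\<bar>} z * hilbert_kernel h x z \<partial>lborel)" .
qed

text \<open>Removing the truncation adds the integral of a kernel bounded by C over
  [-\<epsilon>, \<epsilon>], hence an error of at most 2 C \<epsilon>.\<close>

lemma has_hilbert_lipschitz:
  "has_hilbert h x ((1 / pi) * (\<integral>z. hilbert_kernel h x z \<partial>lborel))"
proof -
  let ?k = "hilbert_kernel h x"
  let ?J = "\<lambda>\<epsilon>. LINT y:{y. \<epsilon> < \<bar>x - y\<bar>}|lborel. h y / (x - y)"
  have diff: "\<bar>?J \<epsilon> - (\<integral>z. ?k z \<partial>lborel)\<bar> \<le> C * (2 * \<epsilon>)" if "\<epsilon> > 0" for \<epsilon>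
  proof -
    have i: "integrable lborel (\<lambda>z. indicator {z. \<epsilon> < \<bar>z\<bar>} z * ?k z)"
      by (rule Bochner_Integration.integrable_bound[OF hilbert_kernel_integrable[of x]])
        (auto simp: indicator_def)
    have "?J \<epsilon> - (\<integral>z. ?k z \<partial>lborel) = (\<integral>z. indicator {z. \<epsilon> < \<bar>z\<bar>} z * ?k z - ?k z \<partial>lborel)"
      unfolding set_lebesgue_integral_def truncated_hilbert(2)[OF that]
      by (rule Bochner_Integration.integral_diff[symmetric, OF i hilbert_kernel_integrable])
    also have "\<bar>\<dots>\<bar> \<le> (\<integral>z. C * indicator {-\<epsilon>..\<epsilon>} z \<partial>lborel)"
      unfolding real_norm_def[symmetric, of "integral\<^sup>L _ _"]
    proof (rule Bochner_Integration.integral_norm_bound_integral)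
      show "integrable lborel (\<lambda>z. indicator {z. \<epsilon> < \<bar>z\<bar>} z * ?k z - ?k z)"
        by (rule Bochner_Integration.integrable_diff[OF i hilbert_kernel_integrable])
      show "integrable lborel (\<lambda>z. C * indicator {-\<epsilon>..\<epsilon>} z)"
        by (intro integrable_mult_right integrable_real_indicator) (auto simp: emeasure_lborel_Icc_eq)
      fix z
      show "norm (indicator {z. \<epsilon> < \<bar>z\<bar>} z * ?k z - ?k z) \<le> C * indicator {-\<epsilon>..\<epsilon>} z"
      proof -
        have "\<bar>?k z\<bar> \<le> C"
          using hilbert_kernel_bound[of x z] lipschitz_const_nonneg
          by (cases "z \<in> {-(\<bar>x\<bar> + 1)..\<bar>x\<bar> + 1}") auto
        then show ?thesis by (auto simp: indicator_def)
      qed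
    qed
    also have "\<dots> = C * (2 * \<epsilon>)" using that by simp
    finally show ?thesis .
  qed
  have "((\<lambda>\<epsilon>. ?J \<epsilon> - (\<integral>z. ?k z \<partial>lborel)) \<longlongrightarrow> 0) (at_right 0)"
  proof (rule Lim_null_comparison)
    show "\<forall>\<^sub>F \<epsilon> in at_right 0. norm (?J \<epsilon> - (\<integral>z. ?k z \<partial>lborel)) \<le> C * (2 * \<epsilon>)"
      using eventually_at_right_less[of "0::real"] by eventually_elim (use diff in simp)
    show "((\<lambda>\<epsilon>. C * (2 * \<epsilon>)) \<longlongrightarrow> 0) (at_right 0)"
      by (rule tendsto_eq_intros refl | simp)+
  qed
  then have "(?J \<longlongrightarrow> (\<integral>z. ?k z \<partial>lborel)) (at_right 0)"
    by (simp add: LIM_zero_iff)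
  then have "((\<lambda>\<epsilon>. (1 / pi) * ?J \<epsilon>) \<longlongrightarrow> (1 / pi) * (\<integral>z. ?k z \<partial>lborel)) (at_right 0)"
    by (rule tendsto_mult_left)
  then show ?thesis
    unfolding has_hilbert_def using truncated_hilbert(1) by (simp add: set_integrable_def)
qed

text \<open>For |x| <= 2 the kernel is at most C on an interval of length at most 6, and 36 = 180 /
  5 with 1 + x^2 <= 5. For |x| > 2 it lives within distance 1 of x and -x, where it is O(C / |x|);
  this gives 64 C^2 / x^2, and 1 / x^2 <= 2 / (1 + x^2) leads to 128 <= 180.\<close>

lemma hilbert_kernel_integral_decay:
  "(\<integral>z. hilbert_kernel h x z \<partial>lborel)\<^sup>2 \<le> 180 * C\<^sup>2 * inverse (1 + x\<^sup>2)"
proof (cases "\<bar>x\<bar> \<le> 2")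
  case True
  have "\<bar>\<integral>z. hilbert_kernel h x z \<partial>lborel\<bar> \<le> (\<integral>z. C * indicator {-(\<bar>x\<bar> + 1)..\<bar>x\<bar> + 1} z \<partial>lborel)"
    unfolding real_norm_def[symmetric, of "integral\<^sup>L _ _"]
    by (rule Bochner_Integration.integral_norm_bound_integral[OF hilbert_kernel_integrable])
      (use hilbert_kernel_bound[of x] in \<open>auto intro!: integrable_mult_right integrable_real_indicator\<close>)
  also have "\<dots> = C * (2 * (\<bar>x\<bar> + 1))" by simp
  also have "\<dots> \<le> C * 6" using True lipschitz_const_nonneg by (intro mult_left_mono) auto
  finally have "(\<integral>z. hilbert_kernel h x z \<partial>lborel)\<^sup>2 \<le> (C * 6)\<^sup>2"
    using power_mono[of "\<bar>\<integral>z. hilbert_kernel h x z \<partial>lborel\<bar>" "C * 6" 2] by simp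
  also have "\<dots> = 180 * C\<^sup>2 * inverse (1 + 2\<^sup>2)" by (simp add: power_mult_distrib)
  also have "\<dots> \<le> 180 * C\<^sup>2 * inverse (1 + x\<^sup>2)"
  proof -
    have "x\<^sup>2 \<le> 2\<^sup>2" using power_mono[OF True, of 2] by simp
    then show ?thesis by (intro mult_left_mono le_imp_inverse_le add_left_mono) (auto intro: add_pos_nonneg)
  qed
  finally show ?thesis .
next
  case False
  let ?b = "\<lambda>z. (2 * C / \<bar>x\<bar>) * (indicator {x - 1..x + 1} z + indicator {-x - 1..-x + 1} z)"
  have "\<bar>\<integral>z. hilbert_kernel h x z \<partial>lborel\<bar> \<le> (\<integral>z. ?b z \<partial>lborel)"
    unfolding real_norm_def[symmetric, of "integral\<^sup>L _ _"]
  proof (rule Bochner_Integration.integral_norm_bound_integral[OF hilbert_kernel_integrable])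
    show "integrable lborel ?b"
      by (intro integrable_mult_right Bochner_Integration.integrable_add integrable_real_indicator) auto
    fix z
    let ?I = "indicator {x - 1..x + 1} z + indicator {-x - 1..-x + 1} z :: real"
    have h: "\<bar>h (x - z) - h (x + z)\<bar> \<le> 2 * C * ?I"
    proof -
      have "\<bar>h (x - z)\<bar> \<le> 2 * C * indicator {x - 1..x + 1} z"
        using bounded_of_lipschitz[of "x - z"] by (auto simp: indicator_def)
      moreover have "\<bar>h (x + z)\<bar> \<le> 2 * C * indicator {-x - 1..-x + 1} z"
        using bounded_of_lipschitz[of "x + z"] by (auto simp: indicator_def)
      ultimately show ?thesis by (simp add: distrib_left)
    qed
    show "norm (hilbert_kernel h x z) \<le> ?b z"
    proof (cases "?I = 0")
      case True
      then show ?thesis using h by (simp add: hilbert_kernel_def)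
    next
      case I: False
      then have "z \<in> {x - 1..x + 1} \<or> z \<in> {-x - 1..-x + 1}" by (auto simp: indicator_def)
      \<comment> \<open>On these intervals |z| >= |x| - 1, and |x| > 2 makes this at least |x| /
        2.\<close>
      then have "\<bar>x\<bar> \<le> 2 * \<bar>z\<bar>" using False by auto
      then have "\<bar>h (x - z) - h (x + z)\<bar> / (2 * \<bar>z\<bar>) \<le> 2 * C * ?I / \<bar>x\<bar>"
        using h False lipschitz_const_nonneg by (intro frac_le) auto
      then show ?thesis by (simp add: hilbert_kernel_def abs_mult)
    qed
  qed
  also have "(\<integral>z. ?b z \<partial>lborel) = 8 * C / \<bar>x\<bar>" by simp
  finally have "(\<integral>z. hilbert_kernel h x z \<partial>lborel)\<^sup>2 \<le> (8 * C / \<bar>x\<bar>)\<^sup>2"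
    using power_mono[of "\<bar>\<integral>z. hilbert_kernel h x z \<partial>lborel\<bar>" _ 2] by simp
  also have "\<dots> = 64 * C\<^sup>2 * inverse (x\<^sup>2)"
    by (simp add: power_mult_distrib power_divide field_simps)
  also have "\<dots> \<le> 64 * C\<^sup>2 * (2 * inverse (1 + x\<^sup>2))"
  proof -
    have "1 \<le> x\<^sup>2" using False power_mono[of 1 "\<bar>x\<bar>" 2] by simp
    moreover have "inverse w \<le> 2 * inverse (1 + w)" if "1 \<le> w" for w :: real
      using that by (simp add: field_simps)
    ultimately have "inverse (x\<^sup>2) \<le> 2 * inverse (1 + x\<^sup>2)" by blast
    then show ?thesis by (rule mult_left_mono) simp
  qed
  also have "\<dots> \<le> 180 * C\<^sup>2 * inverse (1 + x\<^sup>2)"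
    by (simp add: mult_right_mono)
  finally show ?thesis .
qed

text \<open>Pointwise decay like 1 / |x| takes the place of the L2 isometry of the transform;
  measurability comes from the joint measurability of the kernel.\<close>

lemma L2_hilbert_lipschitz: "L2 (hilbert h)"
proof -
  have e: "hilbert h = (\<lambda>x. (1 / pi) * (\<integral>z. hilbert_kernel h x z \<partial>lborel))"
    by (intro ext has_hilbert_imp_hilbert has_hilbert_lipschitz)
  have m [measurable]: "hilbert h \<in> borel_measurable borel"
    unfolding e by measurable
  have i: "integrable lborel (\<lambda>x::real. inverse (1 + x\<^sup>2))"
    using integrable_inverse_1_plus_square by (simp add: set_integrable_def einterval_def)
  have "integrable lborel (\<lambda>x. (hilbert h x)\<^sup>2)"
  proof (rule Bochner_Integration.integrable_bound)
    show "integrable lborel (\<lambda>x. (1 / pi)\<^sup>2 * (180 * C\<^sup>2 * inverse (1 + x\<^sup>2)))"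
      by (intro integrable_mult_right i)
    have "(hilbert h x)\<^sup>2 \<le> (1 / pi)\<^sup>2 * (180 * C\<^sup>2 * inverse (1 + x\<^sup>2))" for x
      unfolding e power_mult_distrib by (intro mult_left_mono hilbert_kernel_integral_decay) simp
    then show "AE x in lborel. norm ((hilbert h x)\<^sup>2) \<le> norm ((1 / pi)\<^sup>2 * (180 * C\<^sup>2 * inverse (1 + x\<^sup>2)))"
      by (intro AE_I2) (metis abs_of_nonneg order_trans real_norm_def zero_le_power2 abs_ge_self)
  qed measurable
  then show ?thesis unfolding L2_def by simp
qed

text \<open>\<open>hilbert\<close> is a bare \<open>Lim\<close>, which says nothing about existence.
  Here the limit exists, so the linearity and dilation rules apply to the value.\<close>

lemma has_hilbert_hilbert: "has_hilbert h x (hilbert h x)"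
  using has_hilbert_lipschitz[of x] has_hilbert_imp_hilbert by metis

end

section \<open>Square-integrable functions and the weak formulation\<close>

lemma L2_mult_integrable:
  assumes "L2 f" "L2 g"
  shows "integrable lborel (\<lambda>x. f x * g x)"
proof (rule Bochner_Integration.integrable_bound)
  show "integrable lborel (\<lambda>x. (f x)\<^sup>2 + (g x)\<^sup>2)"
    using assms by (auto simp: L2_def)
  have "\<bar>f x * g x\<bar> \<le> (f x)\<^sup>2 + (g x)\<^sup>2" for x
  proof -
    have "0 \<le> (\<bar>f x\<bar> - \<bar>g x\<bar>)\<^sup>2" by simp
    then have "2 * \<bar>f x * g x\<bar> \<le> (f x)\<^sup>2 + (g x)\<^sup>2" by (simp add: power2_diff abs_mult)
    then show ?thesis using abs_ge_zero[of "f x * g x"] by linarith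
  qed
  then show "AE x in lborel. norm (f x * g x) \<le> norm ((f x)\<^sup>2 + (g x)\<^sup>2)" by simp
  show "(\<lambda>x. f x * g x) \<in> borel_measurable lborel"
    using assms by (auto simp: L2_def)
qed

lemma L2_diff:
  assumes "L2 f" "L2 g"
  shows "L2 (\<lambda>x. f x - g x)"
proof -
  have "integrable lborel (\<lambda>x. (f x)\<^sup>2 + (g x)\<^sup>2 - 2 * (f x * g x))"
    using assms L2_mult_integrable[OF assms] by (auto simp: L2_def)
  then show ?thesis using assms by (auto simp: L2_def power2_diff mult.assoc)
qed

lemma L2_cmult: "L2 f \<Longrightarrow> L2 (\<lambda>x. a * f x)"
  by (auto simp: L2_def power_mult_distrib)

text \<open>Serves to write u^2 \<phi>' as the product of the two square-integrable functions u and
  u \<phi>'.\<close>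

lemma L2_mult_bounded:
  assumes "L2 f" "g \<in> borel_measurable borel" "\<And>x. \<bar>g x\<bar> \<le> B"
  shows "L2 (\<lambda>x. f x * g x)"
proof -
  have [measurable]: "f \<in> borel_measurable borel" "g \<in> borel_measurable borel"
    using assms by (auto simp: L2_def)
  have "integrable lborel (\<lambda>x. (f x * g x)\<^sup>2)"
  proof (rule Bochner_Integration.integrable_bound)
    show "integrable lborel (\<lambda>x. B\<^sup>2 * (f x)\<^sup>2)" using assms by (auto simp: L2_def)
    have "(g x)\<^sup>2 \<le> B\<^sup>2" for x using power_mono[OF assms(3)[of x], of 2] by simp
    then have "(f x)\<^sup>2 * (g x)\<^sup>2 \<le> (f x)\<^sup>2 * B\<^sup>2" for x
      by (rule mult_left_mono) simp
    then have "(f x * g x)\<^sup>2 \<le> B\<^sup>2 * (f x)\<^sup>2" for x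
      by (simp add: power_mult_distrib mult.commute)
    then show "AE x in lborel. norm ((f x * g x)\<^sup>2) \<le> norm (B\<^sup>2 * (f x)\<^sup>2)" by simp
  qed measurable
  then show ?thesis by (simp add: L2_def)
qed

lemma L2_dilation:
  assumes "L2 f" "0 < R"
  shows "L2 (\<lambda>x. f (x / R))" and "(LINT x|lborel. (f (x / R))\<^sup>2) = R * (LINT x|lborel. (f x)\<^sup>2)"
proof -
  have [measurable]: "f \<in> borel_measurable borel" using assms by (auto simp: L2_def)
  show "L2 (\<lambda>x. f (x / R))"
    using lborel_integrable_real_affine[of "\<lambda>x. (f x)\<^sup>2" "1 / R" 0] assms by (simp add: L2_def)
  show "(LINT x|lborel. (f (x / R))\<^sup>2) = R * (LINT x|lborel. (f x)\<^sup>2)"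
    using lborel_integral_real_affine[of "1 / R" "\<lambda>x. (f x)\<^sup>2" 0] assms(2) by simp
qed

lemma L2_Cauchy_Schwarz:
  assumes "L2 f" "L2 g"
  shows "\<bar>LINT x|lborel. f x * g x\<bar> \<le> sqrt (LINT x|lborel. (f x)\<^sup>2) * sqrt (LINT x|lborel. (g x)\<^sup>2)"
proof -
  define A P B where "A = (LINT x|lborel. (f x)\<^sup>2)" and "P = (LINT x|lborel. f x * g x)"
    and "B = (LINT x|lborel. (g x)\<^sup>2)"
  have q: "0 \<le> A - 2 * r * P + r\<^sup>2 * B" for r
  proof -
    have "0 \<le> (LINT x|lborel. (f x - r * g x)\<^sup>2)" by simp
    also have "\<dots> = (LINT x|lborel. (f x)\<^sup>2 - 2 * r * (f x * g x) + r\<^sup>2 * (g x)\<^sup>2)"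
      by (intro Bochner_Integration.integral_cong) (auto simp: power2_diff power_mult_distrib)
    also have "\<dots> = A - 2 * r * P + r\<^sup>2 * B"
      using assms L2_mult_integrable[OF assms] by (simp add: L2_def A_def P_def B_def)
    finally show ?thesis .
  qed
  have B0: "0 \<le> B" by (simp add: B_def)
  have "P\<^sup>2 \<le> A * B"
  proof (cases "B = 0")
    case True
    have "P = 0"
    proof (rule ccontr)
      assume "P \<noteq> 0"
      \<comment> \<open>With B = 0 the quadratic is affine in r; this r gives it the value A - (A +
        1) = -1.\<close>
      then show False using q[of "(A + 1) / (2 * P)"] True by simp
    qed
    then show ?thesis using True by simp
  next
    case False
    \<comment> \<open>The minimiser of the quadratic in r.\<close>
    then show ?thesis using q[of "P / B"] B0 by (simp add: field_simps power2_eq_square)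
  qed
  then have "sqrt (P\<^sup>2) \<le> sqrt (A * B)" by (rule real_sqrt_le_mono)
  then show ?thesis by (simp add: real_sqrt_mult A_def P_def B_def)
qed

section \<open>The flux of the weak formulation and its integral in time\<close>

definition BO_flux :: "(real \<Rightarrow> real) \<Rightarrow> (real \<Rightarrow> real \<Rightarrow> real) \<Rightarrow> real \<Rightarrow> real" where
  "BO_flux \<phi> u s = (LINT x|lborel.
     - u x s * hilbert (deriv (deriv \<phi>)) x + (u x s)\<^sup>2 / 2 * deriv \<phi> x)"

lemma BO_flux_eq:
  assumes "L2 (\<lambda>x. u x s)" "L2 (hilbert (deriv (deriv \<phi>)))"
    and "deriv \<phi> \<in> borel_measurable borel" "\<And>x. \<bar>deriv \<phi> x\<bar> \<le> B"
  shows "BO_flux \<phi> u s = - (LINT x|lborel. u x s * hilbert (deriv (deriv \<phi>)) x)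
     + (LINT x|lborel. (u x s)\<^sup>2 * deriv \<phi> x) / 2"
proof -
  have i1: "integrable lborel (\<lambda>x. u x s * hilbert (deriv (deriv \<phi>)) x)"
    by (rule L2_mult_integrable[OF assms(1,2)])
  have i2: "integrable lborel (\<lambda>x. (u x s)\<^sup>2 * deriv \<phi> x)"
    using L2_mult_integrable[OF assms(1) L2_mult_bounded[OF assms(1,3,4)]]
    by (simp add: power2_eq_square mult.assoc)
  have "BO_flux \<phi> u s = (LINT x|lborel. - (u x s * hilbert (deriv (deriv \<phi>)) x) + (u x s)\<^sup>2 * deriv \<phi> x / 2)"
    unfolding BO_flux_def by (intro Bochner_Integration.integral_cong) auto
  then show ?thesis using i1 i2 by simp
qed

text \<open>With v = u(s) - u(t) one has u(s)^2 - u(t)^2 = v^2 + 2 v u(t), so the change of flux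
  consists of terms linear and quadratic in v, each controlled by the L2 norm of v. Continuity in
  time is what makes the time integrals genuine, rather than the default 0 of a non-integrable
  function.\<close>

lemma BO_flux_continuous:
  assumes "C_L2 u" and k: "L2 (hilbert (deriv (deriv \<phi>)))"
    and d: "deriv \<phi> \<in> borel_measurable borel" "\<And>x. \<bar>deriv \<phi> x\<bar> \<le> B"
  shows "isCont (BO_flux \<phi> u) t"
proof -
  define k' \<psi> where "k' = hilbert (deriv (deriv \<phi>))" and "\<psi> = deriv \<phi>"
  have k': "L2 k'" and psi [measurable]: "\<psi> \<in> borel_measurable borel" and psiB: "\<And>x. \<bar>\<psi> x\<bar> \<le> B"
    using k d by (auto simp: k'_def \<psi>_def)
  have uL: "L2 (\<lambda>x. u x s)" for s using assms(1) by (simp add: C_L2_def)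
  define e where "e s = (LINT x|lborel. (u x s - u x t)\<^sup>2)" for s
  have e0: "(e \<longlongrightarrow> 0) (at t)" using assms(1) unfolding C_L2_def e_def by blast
  define N1 N2 where "N1 = sqrt (LINT x|lborel. (k' x)\<^sup>2)" and "N2 = sqrt (LINT x|lborel. (u x t * \<psi> x)\<^sup>2)"
  have uB: "L2 (\<lambda>x. u x t * \<psi> x)" by (rule L2_mult_bounded[OF uL psi psiB])
  have "\<bar>BO_flux \<phi> u s - BO_flux \<phi> u t\<bar> \<le> sqrt (e s) * N1 + B / 2 * e s + sqrt (e s) * N2" for s
  proof -
    define v where "v x = u x s - u x t" for x
    have v: "L2 v" unfolding v_def by (rule L2_diff[OF uL uL])
    have i1: "integrable lborel (\<lambda>x. v x * k' x)" by (rule L2_mult_integrable[OF v k'])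
    have i2: "integrable lborel (\<lambda>x. (v x)\<^sup>2 * \<psi> x)"
      using L2_mult_integrable[OF v L2_mult_bounded[OF v psi psiB]] by (simp add: power2_eq_square mult.assoc)
    have i3: "integrable lborel (\<lambda>x. v x * (u x t * \<psi> x))" by (rule L2_mult_integrable[OF v uB])
    have j: "integrable lborel (\<lambda>x. - u x s * k' x + (u x s)\<^sup>2 / 2 * \<psi> x)" for s
    proof -
      have "integrable lborel (\<lambda>x. - (u x s * k' x) + u x s * (u x s * \<psi> x) / 2)"
        using L2_mult_integrable[OF uL k'] L2_mult_integrable[OF uL L2_mult_bounded[OF uL psi psiB]] by simp
      then show ?thesis by (simp add: power2_eq_square mult.assoc)
    qed
    have flux: "BO_flux \<phi> u r = (LINT x|lborel. - u x r * k' x + (u x r)\<^sup>2 / 2 * \<psi> x)" for r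
      by (simp add: BO_flux_def k'_def \<psi>_def)
    have "BO_flux \<phi> u s - BO_flux \<phi> u t =
       (LINT x|lborel. - (v x * k' x) + (v x)\<^sup>2 * \<psi> x / 2 + v x * (u x t * \<psi> x))"
      unfolding flux Bochner_Integration.integral_diff[OF j j, symmetric]
      by (intro Bochner_Integration.integral_cong refl) (simp add: v_def power2_eq_square field_simps)
    also have "\<dots> = - (LINT x|lborel. v x * k' x) + (LINT x|lborel. (v x)\<^sup>2 * \<psi> x) / 2
        + (LINT x|lborel. v x * (u x t * \<psi> x))"
      using i1 i2 i3 by simp
    finally have eq: "BO_flux \<phi> u s - BO_flux \<phi> u t = - (LINT x|lborel. v x * k' x)
        + (LINT x|lborel. (v x)\<^sup>2 * \<psi> x) / 2 + (LINT x|lborel. v x * (u x t * \<psi> x))" .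
    have es: "(LINT x|lborel. (v x)\<^sup>2) = e s" by (simp add: e_def v_def)
    have b1: "\<bar>LINT x|lborel. v x * k' x\<bar> \<le> sqrt (e s) * N1"
      using L2_Cauchy_Schwarz[OF v k'] by (simp add: es N1_def)
    have b3: "\<bar>LINT x|lborel. v x * (u x t * \<psi> x)\<bar> \<le> sqrt (e s) * N2"
      using L2_Cauchy_Schwarz[OF v uB] by (simp add: es N2_def)
    have "\<bar>LINT x|lborel. (v x)\<^sup>2 * \<psi> x\<bar> \<le> (LINT x|lborel. (v x)\<^sup>2 * B)"
      unfolding real_norm_def[symmetric]
      by (rule Bochner_Integration.integral_norm_bound_integral[OF i2])
        (use v psiB in \<open>auto simp: L2_def abs_mult intro!: mult_left_mono\<close>)
    also have "\<dots> = B * e s" by (simp add: es)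
    finally show ?thesis using b1 b3 unfolding eq by linarith
  qed
  moreover have "((\<lambda>s. sqrt (e s) * N1 + B / 2 * e s + sqrt (e s) * N2) \<longlongrightarrow> 0) (at t)"
    by (rule tendsto_eq_intros refl e0 | simp)+
  ultimately have "((\<lambda>s. BO_flux \<phi> u s - BO_flux \<phi> u t) \<longlongrightarrow> 0) (at t)"
    unfolding real_norm_def[symmetric] by (rule Lim_null_comparison[OF always_eventually[OF allI]])
  then show ?thesis by (simp add: isCont_def LIM_zero_iff)
qed

lemma BO_flux_lower_bound_imp:
  assumes sol: "BO_solution u0 u" and phi: "test_fun \<phi>" and k: "L2 (hilbert (deriv (deriv \<phi>)))"
    and d: "deriv \<phi> \<in> borel_measurable borel" "\<And>x. \<bar>deriv \<phi> x\<bar> \<le> B"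
    and T: "0 \<le> T1" "T1 \<le> T2" and m: "\<And>s. s \<in> {T1..T2} \<Longrightarrow> m \<le> BO_flux \<phi> u s"
  shows "m * (T2 - T1) \<le> (LINT x|lborel. u x T2 * \<phi> x) - (LINT x|lborel. u x T1 * \<phi> x)"
proof -
  have "C_L2 u" using sol by (simp add: BO_solution_def)
  then have cont: "continuous_on S (BO_flux \<phi> u)" for S
    by (intro continuous_at_imp_continuous_on ballI BO_flux_continuous[OF _ k d])
  have w: "(LINT x|lborel. u x t * \<phi> x) = (LINT x|lborel. u0 x * \<phi> x) + (LBINT s=0..t. BO_flux \<phi> u s)" for t
    using sol phi unfolding BO_solution_def BO_flux_def by blast
  \<comment> \<open>Additivity of interval integrals asks for integrability on the hull of the three
    end points, which is [0, T2].\<close>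
  have mm: "min (ereal 0) (min (ereal T1) (ereal T2)) = ereal 0" "max (ereal 0) (max (ereal T1) (ereal T2)) = ereal T2"
    using T by (auto simp: min_def max_def)
  have "interval_lebesgue_integrable lborel (ereal 0) (ereal T2) (BO_flux \<phi> u)"
    by (rule interval_integrable_continuous_on) (use T cont in auto)
  then have "(LBINT s=ereal 0..ereal T1. BO_flux \<phi> u s) + (LBINT s=T1..T2. BO_flux \<phi> u s) = (LBINT s=ereal 0..ereal T2. BO_flux \<phi> u s)"
    using interval_integral_sum[of "ereal 0" "ereal T1" "ereal T2" "BO_flux \<phi> u"] unfolding mm by blast
  then have "(LBINT s=T1..T2. BO_flux \<phi> u s) = (LINT x|lborel. u x T2 * \<phi> x) - (LINT x|lborel. u x T1 * \<phi> x)"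
    using w[of T1] w[of T2] by (simp add: zero_ereal_def)
  moreover have "(LBINT s=T1..T2. BO_flux \<phi> u s) = integral {T1..T2} (BO_flux \<phi> u)"
    by (rule interval_integral_eq_integral[OF T(2)]) (rule borel_integrable_atLeastAtMost'[OF cont])
  moreover have "integral {T1..T2} (\<lambda>_. m) \<le> integral {T1..T2} (BO_flux \<phi> u)"
    by (rule integral_le) (use m cont in \<open>auto intro!: integrable_continuous_interval\<close>)
  ultimately show ?thesis using T by (simp add: mult.commute)
qed

section \<open>Local mass\<close>

text \<open>On |x| <= 1/2 one has 1 - x^2 >= 3/4, whence the 4/3 in the exponent. This half-width is
  the reason why balls of radius \<open>R / 2\<close> occur below.\<close>

lemma bump_bounds:
  shows "0 \<le> bump_term 1 0 x" "bump_term 1 0 x \<le> 1"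
    and "\<bar>x\<bar> \<le> 1 / 2 \<Longrightarrow> exp (- (4 / 3)) \<le> bump_term 1 0 x"
proof -
  show "0 \<le> bump_term 1 0 x" by (simp add: bump_term_def)
  show "bump_term 1 0 x \<le> 1"
    using one_minus_square_pos[of x] by (auto simp: bump_term_def)
  assume x: "\<bar>x\<bar> \<le> 1 / 2"
  have "x\<^sup>2 \<le> (1 / 2)\<^sup>2" using power_mono[OF x, of 2] by simp
  then have "3 / 4 \<le> 1 - x\<^sup>2" by (simp add: power2_eq_square)
  then have "1 / (1 - x\<^sup>2) \<le> 1 / (3 / 4)" by (intro divide_left_mono) auto
  then show "exp (- (4 / 3)) \<le> bump_term 1 0 x" using x by (simp add: bump_term_def)
qed

lemma bump_primitive:
  obtains G where "\<And>x. (G has_real_derivative bump_term 1 0 x) (at x)"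
    and "\<And>x. 1 \<le> x \<Longrightarrow> G x = G 1" and "\<And>x. x \<le> -1 \<Longrightarrow> G x = G (-1)"
    and "\<And>x y. \<bar>G x - G y\<bar> \<le> 2"
proof -
  have "isCont (bump_term 1 0) x" for x by (rule DERIV_isCont[OF bump_term_deriv])
  then obtain G where G: "\<And>x. (G has_real_derivative bump_term 1 0 x) (at x)"
    using einterval_antiderivative[of "-\<infinity>" "\<infinity>" "bump_term 1 0"]
    by (auto simp: has_real_derivative_iff_has_vector_derivative)
  have lip: "\<bar>G x - G y\<bar> \<le> \<bar>x - y\<bar>" for x y
    using field_differentiable_bound[of UNIV G "bump_term 1 0" 1 x y] G bump_bounds(1,2) by simp
  have cont: "continuous_on S G" for S
    by (intro continuous_at_imp_continuous_on ballI DERIV_isCont[OF G])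
  have zero: "(G has_real_derivative 0) (at y)" if "1 \<le> \<bar>y\<bar>" for y
    using G[of y] bump_term_eq_0[OF that] by simp
  have r: "G x = G 1" if "1 \<le> x" for x
    using DERIV_isconst_end[of 1 x G, OF _ cont] zero that by (cases "x = 1") auto
  have l: "G x = G (-1)" if "x \<le> -1" for x
    using DERIV_isconst_end[of x "-1" G, OF _ cont] zero that by (cases "x = -1") auto
  \<comment> \<open>Clamping the argument to [-1, 1] leaves G unchanged, so the Lipschitz constant 1
    bounds the oscillation by the length 2.\<close>
  have "G x = G (max (-1) (min 1 x))" for x
    using r[of x] l[of x] by (auto simp: max_def min_def)
  then have "\<bar>G x - G y\<bar> \<le> \<bar>max (-1) (min 1 x) - max (-1) (min 1 y)\<bar>" for x y
    using lip by metis
  moreover have "\<bar>max (-1) (min 1 x) - max (-1) (min 1 y)\<bar> \<le> 2" for x y :: real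
    by (auto simp: max_def min_def)
  ultimately have "\<bar>G x - G y\<bar> \<le> 2" for x y by (meson order_trans)
  then show ?thesis using that[of G] G r l by blast
qed

text \<open>Beyond L both dilates of G sit on the same plateau because R <= L, so they cancel. The
  prefactor R normalises the main part of \<phi>' to a bump of height independent of R.\<close>

lemma two_scale_test_function:
  assumes RL: "0 < R" "R \<le> L"
  obtains \<phi> where "test_fun \<phi>"
    and "deriv \<phi> = (\<lambda>x. bump_term 1 0 (x / R) - (R / L) * bump_term 1 0 (x / L))"
    and "\<And>x. \<bar>\<phi> x\<bar> \<le> 2 * R * indicator {-L..L} x" and "\<phi> \<in> borel_measurable borel"
proof -
  obtain G where G: "\<And>x. (G has_real_derivative bump_term 1 0 x) (at x)"
    and r: "\<And>x. 1 \<le> x \<Longrightarrow> G x = G 1" and l: "\<And>x. x \<le> -1 \<Longrightarrow> G x = G (-1)"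
    and b: "\<And>x y. \<bar>G x - G y\<bar> \<le> 2"
    by (rule bump_primitive) blast
  define \<phi> where "\<phi> x = R * (G (x / R) - G (x / L))" for x
  have der: "(\<phi> has_real_derivative bump_term 1 0 (x / R) - (R / L) * bump_term 1 0 (x / L)) (at x)" for x
  proof -
    have s: "((\<lambda>x. G (x / S)) has_real_derivative bump_term 1 0 (x / S) * (1 / S)) (at x)" for x S
      by (rule DERIV_chain2[OF G]) (rule DERIV_cdivide DERIV_ident)+
    show ?thesis unfolding \<phi>_def
      by (rule DERIV_cong[OF DERIV_cmult[OF DERIV_diff[OF s s]]])
        (use RL in \<open>simp add: field_simps\<close>)
  qed
  then have d: "deriv \<phi> = (\<lambda>x. bump_term 1 0 (x / R) - (R / L) * bump_term 1 0 (x / L))"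
    by (intro ext DERIV_imp_deriv)
  have supp: "\<phi> x = 0" if "L < \<bar>x\<bar>" for x
  proof (cases "0 \<le> x")
    case True
    then have "1 \<le> x / R" "1 \<le> x / L" using that RL by (auto simp: field_simps)
    then show ?thesis using r unfolding \<phi>_def by (metis diff_self mult_zero_right)
  next
    case False
    then have "x / R \<le> -1" "x / L \<le> -1" using that RL by (auto simp: field_simps)
    then show ?thesis using l unfolding \<phi>_def by (metis diff_self mult_zero_right)
  qed
  have smooth: "((deriv ^^ k) \<phi>) differentiable (at x)" for k x
  proof (cases k)
    case 0
    then show ?thesis using der by (auto simp: real_differentiable_def)
  next
    \<comment> \<open>\<phi> is built from the primitive G, not from a \<open>bump_term\<close>;
      from the first derivative on it belongs to the two-scale family.\<close>
    case (Suc j)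
    then have "(deriv ^^ k) \<phi> = (deriv ^^ j) (\<lambda>x. 1 * bump_term 1 0 (x / R) - (R / L) * bump_term 1 0 (x / L))"
      by (simp add: funpow_swap1 d)
    then show ?thesis using two_scale_smooth by metis
  qed
  show ?thesis
  proof (rule that)
    show "test_fun \<phi>" unfolding test_fun_def using smooth supp by blast
    show "\<bar>\<phi> x\<bar> \<le> 2 * R * indicator {-L..L} x" for x
      using supp[of x] b[of "x / R" "x / L"] RL
      by (cases "\<bar>x\<bar> \<le> L") (auto simp: \<phi>_def abs_mult indicator_def)
    show "\<phi> \<in> borel_measurable borel"
      by (intro borel_measurable_continuous_onI continuous_at_imp_continuous_on ballI DERIV_isCont[OF der])
  qed (rule d)
qed

lemma bump_term_L2_hilbert: "L2 (hilbert (bump_term p n))"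
proof -
  obtain C where C: "\<And>x y. \<bar>bump_term p n x - bump_term p n y\<bar> \<le> C * \<bar>x - y\<bar>"
    using bump_term_lipschitz[of p n] by blast
  show ?thesis by (rule L2_hilbert_lipschitz[OF bump_term_measurable C bump_term_eq_0])
qed

lemma bump_term_has_hilbert: "has_hilbert (bump_term p n) x (hilbert (bump_term p n) x)"
proof -
  obtain C where C: "\<And>x y. \<bar>bump_term p n x - bump_term p n y\<bar> \<le> C * \<bar>x - y\<bar>"
    using bump_term_lipschitz[of p n] by blast
  show ?thesis by (rule has_hilbert_hilbert[OF bump_term_measurable C bump_term_eq_0])
qed

lemma hilbert_two_scale:
  assumes "0 < R" "0 < L"
  shows "hilbert (\<lambda>x. a * bump_term p n (x / R) - d * bump_term q m (x / L))
    = (\<lambda>x. a * hilbert (bump_term p n) (x / R) - d * hilbert (bump_term q m) (x / L))"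
  by (intro ext has_hilbert_imp_hilbert has_hilbert_linear has_hilbert_dilation bump_term_has_hilbert assms)

text \<open>A lower bound \<kappa> for the mass throughout the window gives a lower bound m for the
  flux, and m T is at most the difference of the boundary terms. The constant is uniform in T, R and
  L: it depends only on the L2 bound of u and on the bump.\<close>

lemma local_mass_estimate:
  assumes sol: "BO_solution u0 u"
  obtains A where "0 \<le> A"
    and "\<And>T R L \<kappa>. 0 < T \<Longrightarrow> 0 < R \<Longrightarrow> R \<le> L \<Longrightarrow>
      (\<And>s. s \<in> {T..2 * T} \<Longrightarrow> \<kappa> \<le> (LINT x:{x. \<bar>x\<bar> < R / 2}|lborel. (u x s)\<^sup>2)) \<Longrightarrow>
      \<kappa> \<le> A * (R * sqrt L / T + R / L + 1 / sqrt R)"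
proof -
  obtain M where M: "\<And>t. (LINT x|lborel. (u x t)\<^sup>2) \<le> M"
    using sol by (auto simp: BO_solution_def Linf_L2_def)
  have "0 \<le> (LINT x|lborel. (u x 0)\<^sup>2)" by simp
  with M[of 0] have M0: "0 \<le> M" by linarith
  have uL: "L2 (\<lambda>x. u x s)" for s using sol by (simp add: BO_solution_def C_L2_def)
  have CS: "\<bar>LINT x|lborel. u x s * f x\<bar> \<le> sqrt M * sqrt (LINT x|lborel. (f x)\<^sup>2)" if "L2 f" for s f
    by (rule order_trans[OF L2_Cauchy_Schwarz[OF uL that]])
      (intro mult_right_mono real_sqrt_le_mono M; simp)
  define K where "K = hilbert (bump_term (bump_pderiv 1 0) 2)"
  define N where "N = (LINT x|lborel. (K x)\<^sup>2)"
  have KL: "L2 K" unfolding K_def by (rule bump_term_L2_hilbert)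
  define c where "c = exp (- (4 / 3) :: real)"
  have c: "0 < c" by (simp add: c_def)
  \<comment> \<open>The three summands come from the two boundary terms (3 \<open>sqrt M\<close>
    each), the negative part of \<phi>' and the dispersive term; 2 / c undoes the weight c / 2 of
    \<kappa>.\<close>
  define A where "A = (2 / c) * (6 * sqrt M + M + 2 * (sqrt M * sqrt N))"
  have A0: "0 \<le> A" using c M0 by (simp add: A_def N_def)
  show ?thesis
  proof (rule that[OF A0])
    fix T R L \<kappa> :: real
    assume T: "0 < T" and R: "0 < R" and RL: "R \<le> L"
      and low: "\<And>s. s \<in> {T..2 * T} \<Longrightarrow> \<kappa> \<le> (LINT x:{x. \<bar>x\<bar> < R / 2}|lborel. (u x s)\<^sup>2)"
    have L: "0 < L" using R RL by simp
    obtain \<phi> where phi: "test_fun \<phi>"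
      and d: "deriv \<phi> = (\<lambda>x. bump_term 1 0 (x / R) - (R / L) * bump_term 1 0 (x / L))"
      and phib: "\<And>x. \<bar>\<phi> x\<bar> \<le> 2 * R * indicator {-L..L} x" and phim [measurable]: "\<phi> \<in> borel_measurable borel"
      using two_scale_test_function[OF R RL] by blast
    have dm [measurable]: "deriv \<phi> \<in> borel_measurable borel" unfolding d by measurable
    have RL1: "R / L \<le> 1" "0 \<le> R / L" using R RL by auto
    have db: "\<bar>deriv \<phi> x\<bar> \<le> 1" for x
    proof -
      have "(R / L) * bump_term 1 0 (x / L) \<le> 1 * 1"
        using RL1 bump_bounds(1,2) by (intro mult_mono) auto
      moreover have "0 \<le> (R / L) * bump_term 1 0 (x / L)"
        using RL1 bump_bounds(1) by (intro mult_nonneg_nonneg)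
      ultimately show ?thesis using bump_bounds(1,2)[of "x / R"] unfolding d abs_le_iff by simp
    qed
    have dd: "deriv (deriv \<phi>) = (\<lambda>x. (1 / R) * bump_term (bump_pderiv 1 0) 2 (x / R)
        - (R / L / L) * bump_term (bump_pderiv 1 0) 2 (x / L))"
      unfolding d using two_scale_deriv[of 1 1 0 R "R / L" 1 0 L] by (intro ext DERIV_imp_deriv) (simp add: numeral_2_eq_2)
    have k: "hilbert (deriv (deriv \<phi>)) = (\<lambda>x. (1 / R) * K (x / R) - (R / L / L) * K (x / L))"
      unfolding dd K_def by (rule hilbert_two_scale[OF R L])
    have kL: "L2 (hilbert (deriv (deriv \<phi>)))" unfolding k
      by (intro L2_diff L2_cmult L2_dilation(1) KL R L)
    have disp: "(LINT x|lborel. u x s * hilbert (deriv (deriv \<phi>)) x) \<le> 2 * (sqrt M * sqrt N) / sqrt R" for s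
    proof -
      have KS: "\<bar>LINT x|lborel. u x s * K (x / S)\<bar> \<le> sqrt M * sqrt N * sqrt S" if "0 < S" for S
        using CS[OF L2_dilation(1)[OF KL that], of s] L2_dilation(2)[OF KL that]
        by (simp add: N_def real_sqrt_mult ac_simps)
      have i: "integrable lborel (\<lambda>x. u x s * K (x / S))" if "0 < S" for S
        by (rule L2_mult_integrable[OF uL L2_dilation(1)[OF KL that]])
      have "(LINT x|lborel. u x s * hilbert (deriv (deriv \<phi>)) x)
          = (LINT x|lborel. (1 / R) * (u x s * K (x / R)) - (R / L / L) * (u x s * K (x / L)))"
        unfolding k by (intro Bochner_Integration.integral_cong refl) (simp add: algebra_simps)
      also have "\<dots> = (1 / R) * (LINT x|lborel. u x s * K (x / R)) - (R / L / L) * (LINT x|lborel. u x s * K (x / L))"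
        by (simp only: Bochner_Integration.integral_diff[OF integrable_mult_right[OF i[OF R]] integrable_mult_right[OF i[OF L]]]
            integral_mult_right_zero)
      also have "\<dots> \<le> (1 / R) * (sqrt M * sqrt N * sqrt R) + (R / L / L) * (sqrt M * sqrt N * sqrt L)"
      proof -
        have "(1 / R) * (LINT x|lborel. u x s * K (x / R)) \<le> (1 / R) * (sqrt M * sqrt N * sqrt R)"
          using KS[OF R] R by (intro mult_left_mono) auto
        moreover have "(R / L / L) * (- (LINT x|lborel. u x s * K (x / L))) \<le> (R / L / L) * (sqrt M * sqrt N * sqrt L)"
          using KS[OF L] R L by (intro mult_left_mono) auto
        ultimately show ?thesis by simp
      qed
      also have "\<dots> = sqrt M * sqrt N * (1 / sqrt R + (R / L) * (1 / sqrt L))"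
      proof -
        have s: "sqrt R / R = 1 / sqrt R" "sqrt L / L = 1 / sqrt L"
          using R L by (simp_all add: real_div_sqrt field_simps)
        have "(1 / R) * (S * sqrt R) + (R / L / L) * (S * sqrt L) = S * (sqrt R / R + (R / L) * (sqrt L / L))" for S
          by (simp add: algebra_simps)
        then show ?thesis by (simp only: s)
      qed
      \<comment> \<open>The slow scale is absorbed by the fast one: R / L <= 1 and 1 /
        \<open>sqrt L\<close> <= 1 / \<open>sqrt R\<close>.\<close>
      also have "\<dots> \<le> sqrt M * sqrt N * (1 / sqrt R + 1 * (1 / sqrt R))"
        using RL1 R RL M0 by (intro mult_left_mono add_left_mono mult_mono divide_left_mono) (auto simp: N_def)
      finally show ?thesis by (simp add: ac_simps)
    qed
    define m where "m = c * \<kappa> / 2 - (R / L) * M / 2 - 2 * (sqrt M * sqrt N) / sqrt R"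
    have flux: "m \<le> BO_flux \<phi> u s" if s: "s \<in> {T..2 * T}" for s
    proof -
      have i: "integrable lborel (\<lambda>x. (u x s)\<^sup>2)" using uL by (simp add: L2_def)
      have i1: "integrable lborel (\<lambda>x. indicator {x. \<bar>x\<bar> < R / 2} x * (u x s)\<^sup>2)"
        using integrable_mult_indicator[OF _ i, of "{x. \<bar>x\<bar> < R / 2}"] by simp
      have i2: "integrable lborel (\<lambda>x. (u x s)\<^sup>2 * deriv \<phi> x)"
        using L2_mult_integrable[OF uL L2_mult_bounded[OF uL dm db]] by (simp add: power2_eq_square mult.assoc)
      have "c * \<kappa> - (R / L) * M \<le> c * (LINT x|lborel. indicator {x. \<bar>x\<bar> < R / 2} x * (u x s)\<^sup>2)
          - (R / L) * (LINT x|lborel. (u x s)\<^sup>2)"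
        using low[OF s] M[of s] c RL1 by (intro diff_mono mult_left_mono) (auto simp: set_lebesgue_integral_def)
      also have "\<dots> = (LINT x|lborel. c * (indicator {x. \<bar>x\<bar> < R / 2} x * (u x s)\<^sup>2) - (R / L) * (u x s)\<^sup>2)"
        by (simp only: Bochner_Integration.integral_diff[OF integrable_mult_right[OF i1] integrable_mult_right[OF i]]
            integral_mult_right_zero)
      also have "\<dots> \<le> (LINT x|lborel. (u x s)\<^sup>2 * deriv \<phi> x)"
      proof (rule integral_mono)
        show "integrable lborel (\<lambda>x. c * (indicator {x. \<bar>x\<bar> < R / 2} x * (u x s)\<^sup>2) - (R / L) * (u x s)\<^sup>2)"
          by (intro Bochner_Integration.integrable_diff integrable_mult_right i i1)
        fix x
        have "c * indicator {x. \<bar>x\<bar> < R / 2} x - R / L \<le> deriv \<phi> x"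
        proof -
          have "c * indicator {x. \<bar>x\<bar> < R / 2} x \<le> bump_term 1 0 (x / R)"
            using bump_bounds(1)[of "x / R"] bump_bounds(3)[of "x / R"] R
            by (auto simp: indicator_def c_def abs_divide field_simps)
          moreover have "(R / L) * bump_term 1 0 (x / L) \<le> (R / L) * 1"
            using RL1 bump_bounds(2) by (intro mult_left_mono)
          ultimately show ?thesis unfolding d by simp
        qed
        then have "(u x s)\<^sup>2 * (c * indicator {x. \<bar>x\<bar> < R / 2} x - R / L) \<le> (u x s)\<^sup>2 * deriv \<phi> x"
          by (rule mult_left_mono) simp
        then show "c * (indicator {x. \<bar>x\<bar> < R / 2} x * (u x s)\<^sup>2) - (R / L) * (u x s)\<^sup>2 \<le> (u x s)\<^sup>2 * deriv \<phi> x"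
          by (simp add: algebra_simps)
      qed (rule i2)
      finally have low': "c * \<kappa> - (R / L) * M \<le> (LINT x|lborel. (u x s)\<^sup>2 * deriv \<phi> x)" .
      have "p / 2 - q / 2 - D \<le> - I + J / 2" if "p - q \<le> J" "I \<le> D" for p q D I J :: real
        using that by linarith
      from this[OF low' disp[of s]] show ?thesis
        unfolding BO_flux_eq[of u s, OF uL kL dm db] m_def .
    qed
    have phi2: "(LINT x|lborel. (\<phi> x)\<^sup>2) \<le> (3 * R * sqrt L)\<^sup>2" and phiL: "L2 \<phi>"
    proof -
      have b: "(\<phi> x)\<^sup>2 \<le> 4 * R\<^sup>2 * indicator {-L..L} x" for x
        using power_mono[OF phib[of x], of 2] by (auto simp: indicator_def power_mult_distrib)
      have i: "integrable lborel (\<lambda>x. 4 * R\<^sup>2 * indicator {-L..L} x)"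
        by (intro integrable_mult_right integrable_real_indicator) (auto simp: emeasure_lborel_Icc_eq)
      have j: "integrable lborel (\<lambda>x. (\<phi> x)\<^sup>2)"
        by (rule Bochner_Integration.integrable_bound[OF i]) (use b in auto)
      then show "L2 \<phi>" by (simp add: L2_def)
      have "(LINT x|lborel. (\<phi> x)\<^sup>2) \<le> (LINT x|lborel. 4 * R\<^sup>2 * indicator {-L..L} x)"
        by (rule integral_mono[OF j i b])
      also have "\<dots> = 8 * R\<^sup>2 * L" using L by simp
      \<comment> \<open>Rounding 8 up to 9 gives a perfect square.\<close>
      also have "\<dots> \<le> 9 * R\<^sup>2 * L" using L by (intro mult_right_mono) auto
      finally show "(LINT x|lborel. (\<phi> x)\<^sup>2) \<le> (3 * R * sqrt L)\<^sup>2"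
        using L by (simp add: power_mult_distrib)
    qed
    have "sqrt (LINT x|lborel. (\<phi> x)\<^sup>2) \<le> 3 * R * sqrt L"
      using real_sqrt_le_mono[OF phi2] R L by simp
    then have "sqrt M * sqrt (LINT x|lborel. (\<phi> x)\<^sup>2) \<le> sqrt M * (3 * R * sqrt L)"
      using M0 by (intro mult_left_mono) auto
    then have end_bound: "\<bar>LINT x|lborel. u x s * \<phi> x\<bar> \<le> sqrt M * (3 * R * sqrt L)" for s
      using CS[OF phiL, of s] by linarith
    have "m * (2 * T - T) \<le> (LINT x|lborel. u x (2 * T) * \<phi> x) - (LINT x|lborel. u x T * \<phi> x)"
      by (rule BO_flux_lower_bound_imp[OF sol phi kL dm db _ _ flux]) (use T in auto)
    also have "\<dots> \<le> 6 * (sqrt M * (R * sqrt L))"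
      using end_bound[of T] end_bound[of "2 * T"] by (simp add: abs_le_iff)
    finally have "m \<le> 6 * (sqrt M * (R * sqrt L)) / T"
      using T by (simp add: field_simps)
    then have "c / 2 * \<kappa> \<le> 6 * sqrt M * (R * sqrt L / T) + M * (R / L) / 2 + 2 * (sqrt M * sqrt N) * (1 / sqrt R)"
      unfolding m_def by (simp add: algebra_simps)
    also have "\<dots> \<le> (6 * sqrt M + M + 2 * (sqrt M * sqrt N)) * (R * sqrt L / T + R / L + 1 / sqrt R)"
    proof -
      define X Y Z P Q where "X = R * sqrt L / T" and "Y = R / L" and "Z = 1 / sqrt R"
        and "P = 6 * sqrt M" and "Q = 2 * (sqrt M * sqrt N)"
      have pos: "0 \<le> X" "0 \<le> Y" "0 \<le> Z" "0 \<le> P" "0 \<le> Q"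
        using T R L M0 by (auto simp: X_def Y_def Z_def P_def Q_def N_def)
      have "P * X + M * Y / 2 + Q * Z \<le> P * X + M * Y + Q * Z + P * (Y + Z) + M * (X + Z) + Q * (X + Y)"
        using pos M0 by (simp add: add_nonneg_nonneg)
      also have "\<dots> = (P + M + Q) * (X + Y + Z)" by (simp add: algebra_simps)
      finally show ?thesis by (simp add: X_def Y_def Z_def P_def Q_def)
    qed
    finally show "\<kappa> \<le> A * (R * sqrt L / T + R / L + 1 / sqrt R)"
      unfolding A_def using c by (simp add: field_simps)
  qed
qed

text \<open>If the bound failed at all times of the window, the mass would stay above (A + 1) E
  there, while the estimate allows at most A E. The gap between A + 1 and A yields the
  contradiction.\<close>

lemma local_mass_dyadic_decay:
  assumes sol: "BO_solution u0 u" and b: "0 < b" "b < 2 / 3" and a: "0 < a"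
  shows "\<forall>\<^sub>F T in at_top. \<exists>s\<in>{T..2 * T}.
    (LINT x:{x. \<bar>x\<bar> < s powr b}|lborel. (u x s)\<^sup>2) \<le> 1 / ln s powr a"
proof -
  obtain A where A: "0 \<le> A" and est: "\<And>T R L \<kappa>. 0 < T \<Longrightarrow> 0 < R \<Longrightarrow> R \<le> L \<Longrightarrow>
      (\<And>s. s \<in> {T..2 * T} \<Longrightarrow> \<kappa> \<le> (LINT x:{x. \<bar>x\<bar> < R / 2}|lborel. (u x s)\<^sup>2)) \<Longrightarrow>
      \<kappa> \<le> A * (R * sqrt L / T + R / L + 1 / sqrt R)"
    using local_mass_estimate[OF sol] by blast
  \<comment> \<open>\<open>R T / 2\<close> is the largest radius s^b in the window, so one fixed
    ball contains all the moving ones.\<close>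
  define R L where "R T = 2 * (2 * T) powr b" and "L T = T powr (1 - b / 2)" for T
  define E where "E T = R T * sqrt (L T) / T + R T / L T + 1 / sqrt (R T)" for T
  \<comment> \<open>The powers of T in the three limits are 3b/4 - 1/2, 3b/2 - 1 and -b/2; the first
    two are negative because b < 2/3.\<close>
  have "((\<lambda>T. (R T * sqrt (L T) / T) * ln (2 * T) powr a) \<longlongrightarrow> 0) at_top"
    unfolding R_def L_def using b a by (real_asymp simp: field_simps)
  moreover have "((\<lambda>T. (R T / L T) * ln (2 * T) powr a) \<longlongrightarrow> 0) at_top"
    unfolding R_def L_def using b a by real_asymp
  moreover have "((\<lambda>T. (1 / sqrt (R T)) * ln (2 * T) powr a) \<longlongrightarrow> 0) at_top"
    unfolding R_def using b a by real_asymp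
  ultimately have "((\<lambda>T. (A + 1) * ((R T * sqrt (L T) / T) * ln (2 * T) powr a + (R T / L T) * ln (2 * T) powr a
      + (1 / sqrt (R T)) * ln (2 * T) powr a)) \<longlongrightarrow> (A + 1) * (0 + 0 + 0)) at_top"
    by (intro tendsto_intros)
  then have lim: "((\<lambda>T. (A + 1) * (E T * ln (2 * T) powr a)) \<longlongrightarrow> 0) at_top"
    unfolding E_def by (simp only: distrib_right) simp
  have "\<forall>\<^sub>F T in at_top. (A + 1) * (E T * ln (2 * T) powr a) < 1"
    by (rule order_tendstoD(2)[OF lim]) simp
  moreover have "\<forall>\<^sub>F T in at_top. R T \<le> L T"
    unfolding R_def L_def using b by real_asymp
  moreover have "\<forall>\<^sub>F T in at_top. (1::real) < T" by (rule eventually_gt_at_top)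
  ultimately show ?thesis
  proof eventually_elim
    case (elim T)
    have R: "0 < R T" and L: "0 < L T" using elim(3) by (auto simp: R_def L_def)
    have E: "0 < E T" unfolding E_def using R L elim(3) by (intro add_pos_pos) auto
    show ?case
    proof (rule ccontr)
      assume neg: "\<not> (\<exists>s\<in>{T..2 * T}. (LINT x:{x. \<bar>x\<bar> < s powr b}|lborel. (u x s)\<^sup>2) \<le> 1 / ln s powr a)"
      have "(A + 1) * E T \<le> (LINT x:{x. \<bar>x\<bar> < R T / 2}|lborel. (u x s)\<^sup>2)" if s: "s \<in> {T..2 * T}" for s
      proof -
        have i: "integrable lborel (\<lambda>x. (u x s)\<^sup>2)"
          using sol by (simp add: BO_solution_def C_L2_def L2_def)
        have lnpos: "0 < ln s" using s elim(3) by simp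
        have "(A + 1) * E T \<le> 1 / ln (2 * T) powr a"
          using elim by (simp add: field_simps)
        also have "\<dots> \<le> 1 / ln s powr a"
          using s elim(3) lnpos a by (intro divide_left_mono powr_mono2 mult_pos_pos) auto
        also have "\<dots> \<le> (LINT x:{x. \<bar>x\<bar> < s powr b}|lborel. (u x s)\<^sup>2)"
          using neg s by force
        also have "\<dots> \<le> (LINT x:{x. \<bar>x\<bar> < R T / 2}|lborel. (u x s)\<^sup>2)"
        proof -
          have "s powr b \<le> R T / 2" unfolding R_def using s elim(3) b by (simp add: powr_mono2)
          then have "{x. \<bar>x\<bar> < s powr b} \<subseteq> {x. \<bar>x\<bar> < R T / 2}" by auto
          then show ?thesis
            unfolding set_lebesgue_integral_def
            by (intro integral_mono integrable_mult_indicator i) (auto simp: indicator_def)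
        qed
        finally show ?thesis .
      qed
      then have "(A + 1) * E T \<le> A * E T"
        unfolding E_def using elim(2,3) R by (intro est) auto
      then show False using E by (simp add: distrib_right)
    qed
  qed
qed

theorem theorem1p1:
  fixes u0 :: "real \<Rightarrow> real" and u :: "real \<Rightarrow> real \<Rightarrow> real" and b :: real
  assumes "L2 u0"
    and "BO_solution u0 u"
    and "0 < b" and "b < 2 / 3"
  shows "Liminf at_top (\<lambda>t. ereal (LINT x:{x. \<bar>x\<bar> < t powr b}|lborel. (u x t)\<^sup>2)) = 0
     \<and> (\<exists>C > 0. \<exists>tn :: nat \<Rightarrow> real. strict_mono tn \<and> filterlim tn at_top sequentially
           \<and> (\<forall>n. 1 < tn n \<and>
                (LINT x:{x. \<bar>x\<bar> < tn n powr b}|lborel. (u x (tn n))\<^sup>2)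
                  \<le> C / (ln (tn n)) powr ((1 - b) / b)))"
proof -
  define f where "f t = (LINT x:{x. \<bar>x\<bar> < t powr b}|lborel. (u x t)\<^sup>2)" for t
  define a where "a = (1 - b) / b"
  have a: "0 < a" using assms(3,4) by (simp add: a_def)
  have f0: "0 \<le> f t" for t unfolding f_def set_lebesgue_integral_def by simp
  obtain T0 where T0: "\<And>T. T0 \<le> T \<Longrightarrow> \<exists>s\<in>{T..2 * T}. f s \<le> 1 / ln s powr a"
    using local_mass_dyadic_decay[OF assms(2-4) a] unfolding f_def eventually_at_top_linorder by blast
  define T1 where "T1 = max T0 2"
  \<comment> \<open>Ratio 3 against windows of ratio 2 keeps the windows disjoint and ordered, so
    any choice of one time in each is strictly increasing.\<close>
  have "\<exists>s\<in>{3 ^ n * T1..2 * (3 ^ n * T1)}. f s \<le> 1 / ln s powr a" for n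
  proof (rule T0)
    have "1 * T1 \<le> 3 ^ n * T1" by (intro mult_right_mono) (auto simp: T1_def)
    then show "T0 \<le> 3 ^ n * T1" by (simp add: T1_def)
  qed
  then obtain tn where tn: "\<And>n. 3 ^ n * T1 \<le> tn n" "\<And>n. tn n \<le> 2 * (3 ^ n * T1)"
    "\<And>n. f (tn n) \<le> 1 / ln (tn n) powr a"
    by (metis atLeastAtMost_iff)
  have T1: "2 \<le> T1" by (simp add: T1_def)
  have mono: "strict_mono tn"
    unfolding strict_mono_Suc_iff
  proof
    fix n
    have "tn n \<le> 2 * (3 ^ n * T1)" by (rule tn)
    also have "\<dots> < 3 ^ Suc n * T1" using T1 by simp
    also have "\<dots> \<le> tn (Suc n)" by (rule tn)
    finally show "tn n < tn (Suc n)" .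
  qed
  have lim: "filterlim tn at_top sequentially"
  proof (rule filterlim_at_top_mono)
    show "filterlim (\<lambda>n. 3 ^ n * T1) at_top sequentially" using T1 by real_asymp
  qed (use tn(1) in auto)
  have gt1: "1 < tn n" for n
  proof -
    have "1 * T1 \<le> 3 ^ n * T1" using T1 by (intro mult_right_mono) auto
    then show ?thesis using tn(1)[of n] T1 by linarith
  qed
  have "Liminf at_top (\<lambda>t. ereal (f t)) = 0"
  proof (rule antisym)
    have "((\<lambda>t. 1 / ln t powr a) \<longlongrightarrow> 0) at_top" using a by real_asymp
    then have "(\<lambda>n. 1 / ln (tn n) powr a) \<longlonglongrightarrow> 0" by (rule filterlim_compose[OF _ lim])
    then have "(\<lambda>n. f (tn n)) \<longlonglongrightarrow> 0"
      by (rule tendsto_sandwich[OF always_eventually[OF allI[OF f0]] always_eventually[OF allI[OF tn(3)]] tendsto_const])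
    then have lim0: "(\<lambda>n. ereal (f (tn n))) \<longlonglongrightarrow> ereal 0" by (rule tendsto_ereal)
    show "Liminf at_top (\<lambda>t. ereal (f t)) \<le> 0"
    proof (rule ccontr)
      assume "\<not> Liminf at_top (\<lambda>t. ereal (f t)) \<le> 0"
      \<comment> \<open>A level strictly between 0 and the lower limit would eventually lie below f,
        in particular along \<open>tn\<close>, where f tends to 0.\<close>
      then obtain y where y: "0 < y" "y < Liminf at_top (\<lambda>t. ereal (f t))"
        using dense[of 0 "Liminf at_top (\<lambda>t. ereal (f t))"] by (auto simp: not_le)
      from less_LiminfD[OF y(2)] lim have "\<forall>\<^sub>F n in sequentially. y < ereal (f (tn n))"
        by (rule eventually_compose_filterlim)
      moreover have "\<forall>\<^sub>F n in sequentially. ereal (f (tn n)) < y"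
        using order_tendstoD(2)[OF lim0] y(1) by (simp add: zero_ereal_def)
      ultimately have "\<forall>\<^sub>F n :: nat in sequentially. False" by eventually_elim auto
      then show False by simp
    qed
    show "0 \<le> Liminf at_top (\<lambda>t. ereal (f t))"
      by (rule Liminf_bounded) (use f0 in auto)
  qed
  moreover have "\<exists>C > 0. \<exists>tn :: nat \<Rightarrow> real. strict_mono tn \<and> filterlim tn at_top sequentially
      \<and> (\<forall>n. 1 < tn n \<and> f (tn n) \<le> C / (ln (tn n)) powr a)"
    \<comment> \<open>The witness is C = 1, since the power decay has absorbed all
      constants.\<close>
    using mono lim gt1 tn(3) zero_less_one by blast
  ultimately show ?thesis unfolding f_def a_def by blast
qed

end
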